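(* Let $(X,Y,\pi)$ and $(\tilde X,\tilde Y,\tilde\pi)$ be conjugate factor triples under conjugacies $\phi:X\to\tilde X$ and $\psi:Y\to\tilde Y$ (so $\tilde\pi\circ\phi=\psi\circ\pi$). Then: (a) for each $y\in Y$, $|\mathscr{C}_\pi(y)|=|\mathscr{C}_{\tilde\pi}(\psi(y))|$; (b) $c_\pi=c_{\tilde\pi}$.
   Context: All shift spaces are two-sided over finite alphabets. A factor triple $(X,Y,\pi)$ consists of a one-dimensional shift of finite type $X$, a sofic shift $Y$ and a factor code (surjective continuous shift-commuting map) $\pi:X\to Y$. Factor triples $(X,Y,\pi)$ and $(\tilde X,\tilde Y,\tilde\pi)$ are conjugate if there are conjugacies (shift-commuting homeomorphisms) $\phi:X\to\tilde X$ and $\psi:Y\to\tilde Y$ with $\tilde\pi\circ\phi=\psi\circ\pi$. For a factor triple $(X,Y,\pi)$ and $x,x'\in X$, there is a transition from $x$ to $x'$, written $x\to x'$, if for each integer $n$ there is a point $v\in X$ with $\pi(v)=\pi(x)=\pi(x')$, $v_j=x_j$ for all $j\le n$, and, for some $i\ge n$, $v_j=x'_j$ for all $j\ge i$. Write $x\sim x'$ if $x\to x'$ and $x'\to x$; this is an equivalence relation whose classes are called transition classes. $\mathscr{C}_\pi(y)$ is the set of transition classes in $X$ over $y\in Y$ (i.e. contained in $\pi^{-1}(y)$). The class degree is $c_\pi=\min_{y\in Y}|\mathscr{C}_\pi(y)|$. *)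

theory Defs
  imports "HOL-Analysis.Analysis" "HOL-Library.Equipollence" "HOL-Library.Extended_Nat"
begin

text \<open>
  Alphabets are finite subsets of an arbitrary symbol type \<open>'a\<close>. For a finite \<open>A\<close>, the product
  topology on \<open>A\<close>-valued bi-infinite sequences is the subspace topology of the topology below, so the
  topology need not mention the alphabet.
\<close>

definition seq_topology :: "(int \<Rightarrow> 'a) topology" where
  "seq_topology = product_topology (\<lambda>_. discrete_topology UNIV) UNIV"

abbreviation shift_top :: "(int \<Rightarrow> 'a) set \<Rightarrow> (int \<Rightarrow> 'a) topology" where
  "shift_top X \<equiv> subtopology seq_topology X"

definition full_shift :: "'a set \<Rightarrow> (int \<Rightarrow> 'a) set" where
  "full_shift A = {x. \<forall>i. x i \<in> A}"

definition shift :: "(int \<Rightarrow> 'a) \<Rightarrow> int \<Rightarrow> 'a" where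
  "shift x = (\<lambda>i. x (i + 1))"

definition shift_space :: "(int \<Rightarrow> 'a) set \<Rightarrow> bool" where
  "shift_space X \<longleftrightarrow>
     (\<exists>A. finite A \<and> X \<subseteq> full_shift A) \<and> closedin seq_topology X \<and> shift ` X = X"

definition occurs_in :: "'a list \<Rightarrow> (int \<Rightarrow> 'a) \<Rightarrow> bool" where
  "occurs_in w x \<longleftrightarrow> (\<exists>i. \<forall>j < length w. x (i + int j) = w ! j)"

definition shift_of_finite_type :: "(int \<Rightarrow> 'a) set \<Rightarrow> bool" where
  "shift_of_finite_type X \<longleftrightarrow>
     (\<exists>A F. finite A \<and> finite F \<and> F \<subseteq> lists A \<and>
        X = {x \<in> full_shift A. \<forall>w\<in>F. \<not> occurs_in w x})"

definition factor_code ::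
  "(int \<Rightarrow> 'a) set \<Rightarrow> (int \<Rightarrow> 'b) set \<Rightarrow> ((int \<Rightarrow> 'a) \<Rightarrow> (int \<Rightarrow> 'b)) \<Rightarrow> bool" where
  "factor_code X Y \<pi> \<longleftrightarrow>
     continuous_map (shift_top X) (shift_top Y) \<pi> \<and> \<pi> ` X = Y \<and>
     (\<forall>x\<in>X. \<pi> (shift x) = shift (\<pi> x))"

text \<open>
  A sofic shift is a factor of a shift of finite type. A definition cannot quantify over the symbol
  type of the covering shift; natural numbers suffice since every finite alphabet can be renamed
  into them.
\<close>

definition sofic :: "(int \<Rightarrow> 'a) set \<Rightarrow> bool" where
  "sofic Y \<longleftrightarrow>
     shift_space Y \<and>
     (\<exists>(Z :: (int \<Rightarrow> nat) set) \<rho>. shift_of_finite_type Z \<and> factor_code Z Y \<rho>)"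

definition factor_triple ::
  "(int \<Rightarrow> 'a) set \<Rightarrow> (int \<Rightarrow> 'b) set \<Rightarrow> ((int \<Rightarrow> 'a) \<Rightarrow> (int \<Rightarrow> 'b)) \<Rightarrow> bool" where
  "factor_triple X Y \<pi> \<longleftrightarrow> shift_of_finite_type X \<and> sofic Y \<and> factor_code X Y \<pi>"

definition conjugacy ::
  "(int \<Rightarrow> 'a) set \<Rightarrow> (int \<Rightarrow> 'b) set \<Rightarrow> ((int \<Rightarrow> 'a) \<Rightarrow> (int \<Rightarrow> 'b)) \<Rightarrow> bool" where
  "conjugacy X Y \<phi> \<longleftrightarrow>
     homeomorphic_map (shift_top X) (shift_top Y) \<phi> \<and>
     (\<forall>x\<in>X. \<phi> (shift x) = shift (\<phi> x))"

definition transition ::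
  "(int \<Rightarrow> 'a) set \<Rightarrow> ((int \<Rightarrow> 'a) \<Rightarrow> (int \<Rightarrow> 'b)) \<Rightarrow> (int \<Rightarrow> 'a) \<Rightarrow> (int \<Rightarrow> 'a) \<Rightarrow> bool" where
  "transition X \<pi> x x' \<longleftrightarrow>
     x \<in> X \<and> x' \<in> X \<and>
     (\<forall>n. \<exists>v\<in>X. \<pi> v = \<pi> x \<and> \<pi> x = \<pi> x' \<and> (\<forall>j\<le>n. v j = x j) \<and>
            (\<exists>i\<ge>n. \<forall>j\<ge>i. v j = x' j))"

definition transition_rel ::
  "(int \<Rightarrow> 'a) set \<Rightarrow> ((int \<Rightarrow> 'a) \<Rightarrow> (int \<Rightarrow> 'b)) \<Rightarrow> ((int \<Rightarrow> 'a) \<times> (int \<Rightarrow> 'a)) set" where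
  "transition_rel X \<pi> = {(x, x'). transition X \<pi> x x' \<and> transition X \<pi> x' x}"

definition transition_classes ::
  "(int \<Rightarrow> 'a) set \<Rightarrow> ((int \<Rightarrow> 'a) \<Rightarrow> (int \<Rightarrow> 'b)) \<Rightarrow> (int \<Rightarrow> 'b) \<Rightarrow> (int \<Rightarrow> 'a) set set" where
  "transition_classes X \<pi> y =
     {C \<in> X // transition_rel X \<pi>. C \<subseteq> {x \<in> X. \<pi> x = y}}"

text \<open>
  Sizes are taken in \<open>enat\<close>, as \<open>card\<close> would give an infinite set the size \<open>0\<close>. Since \<open>enat\<close> is
  well-ordered, the infimum below is attained whenever \<open>Y\<close> is nonempty; for the empty triple it is
  \<open>\<infinity>\<close>.
\<close>

definition enat_card :: "'a set \<Rightarrow> enat" where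
  "enat_card S = (if finite S then enat (card S) else \<infinity>)"

definition class_degree ::
  "(int \<Rightarrow> 'a) set \<Rightarrow> (int \<Rightarrow> 'b) set \<Rightarrow> ((int \<Rightarrow> 'a) \<Rightarrow> (int \<Rightarrow> 'b)) \<Rightarrow> enat" where
  "class_degree X Y \<pi> = (INF y\<in>Y. enat_card (transition_classes X \<pi> y))"

end

theory Submission
  imports Defs
begin

text \<open>
  The one substantial point is that a conjugacy preserves transitions. A transition is witnessed by
  points \<open>v\<close> that agree with \<open>x\<close> far to the left and with \<open>x'\<close> far to the right. The topology alone
  says nothing about such tails, but a continuous shift-commuting map \<open>\<phi>\<close> on a shift space is a
  sliding block code (the Curtis--Hedlund--Lyndon theorem, \<open>sliding_block_code\<close>): with a fixed radius
  \<open>r\<close>, the symbol of \<open>\<phi> x\<close> at \<open>i\<close> depends only on the symbols of \<open>x\<close> at distance at most \<open>r\<close> from \<open>i\<close>.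
  Hence, if \<open>v\<close> and \<open>x\<close> agree up to \<open>n + r\<close>, then \<open>\<phi> v\<close> and \<open>\<phi> x\<close> agree up to \<open>n\<close>, and similarly for
  right tails; so \<open>\<phi> v\<close> witnesses the transition from \<open>\<phi> x\<close> to \<open>\<phi> x'\<close>
  (\<open>transition_semiconjugate\<close>).

  The same applies to the inverse conjugacies, so \<open>\<phi>\<close> carries the relation \<open>\<sim>\<close> of \<open>X\<close> onto that of
  \<open>X'\<close>. Therefore \<open>C \<mapsto> \<phi> ` C\<close> is a bijection between transition classes, and since \<open>\<psi>\<close> is injective it
  matches the classes over \<open>y\<close> with those over \<open>\<psi> y\<close>. The class degrees are then infima of the same
  sizes, indexed by \<open>Y\<close> and by \<open>Y' = \<psi> ` Y\<close>.
\<close>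

section \<open>Cylinders and shift spaces\<close>

definition cylinder :: "(int \<Rightarrow> 'a) \<Rightarrow> nat \<Rightarrow> (int \<Rightarrow> 'a) set" where
  "cylinder x k = {z. \<forall>i. \<bar>i\<bar> \<le> int k \<longrightarrow> z i = x i}"

lemma openin_cylinder: "openin seq_topology (cylinder x k)"
  unfolding seq_topology_def openin_product_topology_alt
proof (intro ballI)
  fix z assume z: "z \<in> cylinder x k"
  define U where "U i = (if \<bar>i\<bar> \<le> int k then {x i} else UNIV)" for i
  have "finite {i. U i \<noteq> UNIV}"
    by (rule finite_subset[of _ "{- int k..int k}"]) (auto simp: U_def split: if_splits)
  moreover have "z \<in> PiE UNIV U" "PiE UNIV U \<subseteq> cylinder x k"
    using z by (auto simp: cylinder_def U_def PiE_def Pi_def split: if_splits)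
  ultimately show "\<exists>U. finite {i \<in> UNIV. U i \<noteq> topspace (discrete_topology UNIV)} \<and>
      (\<forall>i\<in>UNIV. openin (discrete_topology UNIV) (U i)) \<and> z \<in> PiE UNIV U \<and> PiE UNIV U \<subseteq> cylinder x k"
    by (intro exI[of _ U]) auto
qed

lemma openin_seq_topology_iff:
  "openin seq_topology S \<longleftrightarrow> (\<forall>x\<in>S. \<exists>k. cylinder x k \<subseteq> S)"
proof
  assume S: "openin seq_topology S"
  show "\<forall>x\<in>S. \<exists>k. cylinder x k \<subseteq> S"
  proof
    fix x assume "x \<in> S"
    with S obtain U where U: "finite {i. U i \<noteq> UNIV}" "x \<in> PiE UNIV U" "PiE UNIV U \<subseteq> S"
      unfolding seq_topology_def openin_product_topology_alt by auto
    have "finite ((\<lambda>i. nat \<bar>i\<bar>) ` {i. U i \<noteq> UNIV})"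
      using U(1) by simp
    then obtain k where k: "\<And>i. U i \<noteq> UNIV \<Longrightarrow> nat \<bar>i\<bar> \<le> k"
      unfolding finite_nat_set_iff_bounded_le by auto
    have "cylinder x k \<subseteq> PiE UNIV U"
    proof
      fix z assume z: "z \<in> cylinder x k"
      have "z i \<in> U i" for i
        using k[of i] z U(2) by (cases "U i = UNIV") (auto simp: cylinder_def PiE_def Pi_def)
      then show "z \<in> PiE UNIV U"
        by auto
    qed
    with U(3) show "\<exists>k. cylinder x k \<subseteq> S"
      by blast
  qed
next
  assume S: "\<forall>x\<in>S. \<exists>k. cylinder x k \<subseteq> S"
  show "openin seq_topology S"
  proof (subst openin_subopen, intro ballI)
    fix x assume "x \<in> S"
    with S obtain k where "cylinder x k \<subseteq> S"
      by blast
    moreover have "x \<in> cylinder x k"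
      by (simp add: cylinder_def)
    ultimately show "\<exists>T. openin seq_topology T \<and> x \<in> T \<and> T \<subseteq> S"
      using openin_cylinder by blast
  qed
qed

lemma topspace_seq_topology [simp]: "topspace seq_topology = UNIV"
  by (simp add: seq_topology_def)

lemma occurs_in_shift: "occurs_in w (shift x) \<longleftrightarrow> occurs_in w x"
proof
  assume "occurs_in w (shift x)"
  then obtain i where "\<forall>j<length w. x (i + int j + 1) = w ! j"
    by (auto simp: occurs_in_def shift_def)
  then show "occurs_in w x"
    unfolding occurs_in_def by (intro exI[of _ "i + 1"]) (simp add: algebra_simps)
next
  assume "occurs_in w x"
  then obtain i where "\<forall>j<length w. x (i + int j) = w ! j"
    by (auto simp: occurs_in_def)
  then show "occurs_in w (shift x)"
    unfolding occurs_in_def shift_def by (intro exI[of _ "i - 1"]) (simp add: algebra_simps)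
qed

text \<open>
  A point fails to lie in the shift because of finitely many of its coordinates, holding either a
  symbol outside the alphabet or a forbidden word; so the complement is open.
\<close>

lemma shift_space_shift_of_finite_type:
  assumes "shift_of_finite_type X"
  shows "shift_space X"
proof -
  obtain A F where A: "finite A"
    and X: "X = {x \<in> full_shift A. \<forall>w\<in>F. \<not> occurs_in w x}"
    using assms by (auto simp: shift_of_finite_type_def)
  have "\<exists>k. cylinder x k \<subseteq> - X" if x: "x \<in> - X" for x
  proof -
    consider i where "x i \<notin> A" | w where "w \<in> F" "occurs_in w x"
      using x by (auto simp: X full_shift_def)
    then show ?thesis
    proof cases
      case 1
      then have "cylinder x (nat \<bar>i\<bar>) \<subseteq> - X"
        unfolding cylinder_def X full_shift_def by (auto dest!: spec[of _ i])
      then show ?thesis ..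
    next
      case 2
      then obtain i where i: "\<forall>j<length w. x (i + int j) = w ! j"
        by (auto simp: occurs_in_def)
      have "occurs_in w z" if "z \<in> cylinder x (nat \<bar>i\<bar> + length w)" for z
        unfolding occurs_in_def
      proof (intro exI[of _ i] allI impI)
        fix j assume j: "j < length w"
        then have "\<bar>i + int j\<bar> \<le> int (nat \<bar>i\<bar> + length w)"
          by linarith
        then have "z (i + int j) = x (i + int j)"
          using that by (auto simp: cylinder_def)
        with i j show "z (i + int j) = w ! j"
          by simp
      qed
      with 2 have "cylinder x (nat \<bar>i\<bar> + length w) \<subseteq> - X"
        by (auto simp: X)
      then show ?thesis ..
    qed
  qed
  then have "closedin seq_topology X"
    by (simp add: closedin_def openin_seq_topology_iff Compl_eq_Diff_UNIV)
  moreover have "shift ` X = X"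
  proof
    show "shift ` X \<subseteq> X"
      by (auto simp: X occurs_in_shift) (auto simp: full_shift_def shift_def)
    show "X \<subseteq> shift ` X"
    proof
      fix x assume x: "x \<in> X"
      have eq: "x = shift (\<lambda>i. x (i - 1))"
        by (simp add: shift_def)
      have "(\<lambda>i. x (i - 1)) \<in> X"
        using x occurs_in_shift[of _ "\<lambda>i. x (i - 1)", folded eq]
        by (auto simp: X full_shift_def)
      with eq show "x \<in> shift ` X"
        by blast
    qed
  qed
  ultimately show ?thesis
    using A by (auto simp: shift_space_def X)
qed

lemma compactin_shift_space:
  assumes "shift_space X"
  shows "compactin seq_topology X"
proof -
  obtain A where A: "finite A" "X \<subseteq> full_shift A" and X: "closedin seq_topology X"
    using assms by (auto simp: shift_space_def)
  have "full_shift A = PiE UNIV (\<lambda>_. A)"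
    by (auto simp: full_shift_def PiE_def Pi_def)
  with A(1) have "compactin seq_topology (full_shift A)"
    unfolding seq_topology_def by (simp add: compactin_PiE finite_imp_compactin)
  then show ?thesis
    using A(2) X by (rule closed_compactin)
qed

lemma translate_in_shift_space:
  assumes "shift_space X" "x \<in> X"
  shows "(\<lambda>i. x (i + n)) \<in> X"
proof (induction n rule: int_induct[where k = 0])
  case base
  show ?case using assms by simp
next
  case (step1 n)
  then have "shift (\<lambda>i. x (i + n)) \<in> X"
    using assms(1) by (auto simp: shift_space_def)
  then show ?case
    by (simp add: shift_def algebra_simps)
next
  case (step2 n)
  then obtain z where z: "z \<in> X" "(\<lambda>i. x (i + n)) = shift z"
    using assms(1) by (auto simp: shift_space_def)
  have "z i = x (i + (n - 1))" for i
    using fun_cong[OF z(2), of "i - 1"] by (simp add: shift_def algebra_simps)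
  with z(1) show ?case
    by (metis ext)
qed

section \<open>Sliding block codes\<close>

lemma shift_commuting_translate:
  assumes X: "shift_space X" and comm: "\<And>x. x \<in> X \<Longrightarrow> \<phi> (shift x) = shift (\<phi> x)" and x: "x \<in> X"
  shows "\<phi> (\<lambda>i. x (i + n)) = (\<lambda>i. \<phi> x (i + n))"
proof (induction n rule: int_induct[where k = 0])
  case base
  show ?case by simp
next
  case (step1 n)
  have "\<phi> (shift (\<lambda>i. x (i + n))) = shift (\<lambda>i. \<phi> x (i + n))"
    using comm[OF translate_in_shift_space[OF X x]] step1 by simp
  then show ?case
    by (simp add: shift_def algebra_simps)
next
  case (step2 n)
  have "shift (\<lambda>i. x (i + (n - 1))) = (\<lambda>i. x (i + n))"
    by (simp add: shift_def algebra_simps)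
  then have eq: "shift (\<phi> (\<lambda>i. x (i + (n - 1)))) = (\<lambda>i. \<phi> x (i + n))"
    using comm[OF translate_in_shift_space[OF X x, of "n - 1"]] step2 by simp
  show ?case
  proof
    fix i
    show "\<phi> (\<lambda>i. x (i + (n - 1))) i = \<phi> x (i + (n - 1))"
      using fun_cong[OF eq, of "i - 1"] by (simp add: shift_def algebra_simps)
  qed
qed

text \<open>
  By continuity the symbol of \<open>\<phi> x\<close> at \<open>0\<close> is constant on a cylinder around each point, and finitely
  many of these cylinders cover the compact space \<open>X\<close>; the largest of their radii serves for every
  point. Commutation with the shift moves this from the position \<open>0\<close> to all others.
\<close>

lemma sliding_block_code:
  assumes X: "shift_space X"
    and cont: "continuous_map (shift_top X) seq_topology \<phi>"
    and comm: "\<And>x. x \<in> X \<Longrightarrow> \<phi> (shift x) = shift (\<phi> x)"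
  shows "\<exists>r. \<forall>x\<in>X. \<forall>z\<in>X. \<forall>i. (\<forall>j. \<bar>j - i\<bar> \<le> int r \<longrightarrow> x j = z j) \<longrightarrow> \<phi> x i = \<phi> z i"
proof -
  have "\<exists>k. \<forall>z\<in>X \<inter> cylinder x k. \<phi> z 0 = \<phi> x 0" if x: "x \<in> X" for x
  proof -
    have "openin (shift_top X) {z \<in> topspace (shift_top X). \<phi> z \<in> cylinder (\<phi> x) 0}"
      using cont openin_cylinder by (rule openin_continuous_map_preimage)
    then obtain T where T: "openin seq_topology T" "{z \<in> X. \<phi> z \<in> cylinder (\<phi> x) 0} = T \<inter> X"
      by (auto simp: openin_subtopology)
    have "x \<in> T"
      using x T(2) by (auto simp: cylinder_def)
    with T(1) obtain k where "cylinder x k \<subseteq> T"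
      by (auto simp: openin_seq_topology_iff)
    with T(2) have "\<forall>z\<in>X \<inter> cylinder x k. \<phi> z 0 = \<phi> x 0"
      by (fastforce simp: cylinder_def)
    then show ?thesis ..
  qed
  then obtain k where k: "\<And>x z. x \<in> X \<Longrightarrow> z \<in> X \<Longrightarrow> z \<in> cylinder x (k x) \<Longrightarrow> \<phi> z 0 = \<phi> x 0"
    by (metis IntI)
  have "X \<subseteq> (\<Union>x\<in>X. cylinder x (k x))"
    by (auto simp: cylinder_def)
  then obtain \<F> where \<F>: "finite \<F>" "\<F> \<subseteq> (\<lambda>x. cylinder x (k x)) ` X" "X \<subseteq> \<Union>\<F>"
    using compactin_shift_space[OF X] openin_cylinder
    unfolding compactin_def by (metis (no_types, lifting) imageE)
  obtain S where "S \<subseteq> X" "finite S" "\<F> = (\<lambda>x. cylinder x (k x)) ` S"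
    using finite_subset_image[OF \<F>(1,2)] by blast
  with \<F>(3) have S: "finite S" "S \<subseteq> X" "X \<subseteq> (\<Union>x\<in>S. cylinder x (k x))"
    by simp_all
  obtain r where r: "\<And>x. x \<in> S \<Longrightarrow> k x \<le> r"
    using finite_imageI[OF S(1), of k] unfolding finite_nat_set_iff_bounded_le by auto
  have at_0: "\<phi> x 0 = \<phi> z 0" if "x \<in> X" "z \<in> X" "\<And>j. \<bar>j\<bar> \<le> int r \<Longrightarrow> x j = z j" for x z
  proof -
    obtain s where s: "s \<in> S" "x \<in> cylinder s (k s)"
      using S(3) \<open>x \<in> X\<close> by auto
    have "z \<in> cylinder s (k s)"
      using s r[OF s(1)] that(3) by (fastforce simp: cylinder_def)
    then show ?thesis
      using k s S(2) that by (metis subsetD)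
  qed
  show ?thesis
  proof (intro exI[of _ r] ballI allI impI)
    fix x z i
    assume *: "x \<in> X" "z \<in> X" "\<forall>j. \<bar>j - i\<bar> \<le> int r \<longrightarrow> x j = z j"
    have "\<phi> (\<lambda>j. x (j + i)) 0 = \<phi> (\<lambda>j. z (j + i)) 0"
      using * by (intro at_0 translate_in_shift_space[OF X]) auto
    then show "\<phi> x i = \<phi> z i"
      using * by (simp add: shift_commuting_translate[where \<phi> = \<phi>, OF X comm])
  qed
qed

section \<open>Conjugate factor triples\<close>

text \<open>
  The witness for the bound \<open>n\<close> is the image of a witness for the bound \<open>n + r\<close>, where \<open>r\<close> is the radius
  of \<open>\<phi>\<close>; that image merges with \<open>\<phi> x'\<close> at most \<open>r\<close> positions later. The map \<open>\<psi>\<close> carries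
  equal \<open>\<pi>\<close>-images to equal \<open>\<pi>'\<close>-images, which keeps the image of the witness in the right fibre.
\<close>

lemma transition_semiconjugate:
  assumes X: "shift_space X"
    and cont: "continuous_map (shift_top X) (shift_top X') \<phi>"
    and comm: "\<And>x. x \<in> X \<Longrightarrow> \<phi> (shift x) = shift (\<phi> x)"
    and fib: "\<And>x. x \<in> X \<Longrightarrow> \<pi>' (\<phi> x) = \<psi> (\<pi> x)"
    and trans: "transition X \<pi> x x'"
  shows "transition X' \<pi>' (\<phi> x) (\<phi> x')"
proof -
  have x: "x \<in> X" "x' \<in> X"
    using trans by (auto simp: transition_def)
  have \<phi>: "\<phi> z \<in> X'" if "z \<in> X" for z
    using cont that by (auto simp: continuous_map_in_subtopology)
  obtain r where "\<forall>x\<in>X. \<forall>z\<in>X. \<forall>i. (\<forall>j. \<bar>j - i\<bar> \<le> int r \<longrightarrow> x j = z j) \<longrightarrow> \<phi> x i = \<phi> z i"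
    using sliding_block_code[where \<phi> = \<phi>, OF X continuous_map_into_fulltopology[OF cont] comm] by auto
  then have r: "\<phi> x i = \<phi> z i"
    if "x \<in> X" "z \<in> X" "\<And>j. \<bar>j - i\<bar> \<le> int r \<Longrightarrow> x j = z j" for x z i
    using that by blast
  show ?thesis
    unfolding transition_def
  proof (intro conjI allI)
    fix n
    obtain v i where v: "v \<in> X" "\<pi> v = \<pi> x" "\<pi> x = \<pi> x'" "\<And>j. j \<le> n + int r \<Longrightarrow> v j = x j"
      and i: "i \<ge> n + int r" "\<And>j. j \<ge> i \<Longrightarrow> v j = x' j"
      using trans unfolding transition_def by metis
    have "\<phi> v j = \<phi> x j" if "j \<le> n" for j
      using that by (intro r v x) auto
    moreover have "\<phi> v j = \<phi> x' j" if "j \<ge> i + int r" for j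
      using that by (intro r v x i) auto
    moreover have "i + int r \<ge> n"
      using i(1) by simp
    ultimately show "\<exists>v\<in>X'. \<pi>' v = \<pi>' (\<phi> x) \<and> \<pi>' (\<phi> x) = \<pi>' (\<phi> x') \<and>
        (\<forall>j\<le>n. v j = \<phi> x j) \<and> (\<exists>i\<ge>n. \<forall>j\<ge>i. v j = \<phi> x' j)"
      using v(1-3) x \<phi> fib by (intro bexI[of _ "\<phi> v"]) auto
  qed (use x \<phi> in auto)
qed

lemma conjugacy_inverse:
  assumes X: "shift_space X" and "conjugacy X X' \<phi>"
  obtains \<theta> where "conjugacy X' X \<theta>" "\<And>x. x \<in> X \<Longrightarrow> \<theta> (\<phi> x) = x" "\<And>x. x \<in> X' \<Longrightarrow> \<phi> (\<theta> x) = x"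
proof -
  obtain \<theta> where \<theta>: "homeomorphic_maps (shift_top X) (shift_top X') \<phi> \<theta>"
    using assms by (auto simp: conjugacy_def homeomorphic_map_maps)
  then have inv: "\<And>x. x \<in> X \<Longrightarrow> \<theta> (\<phi> x) = x" "\<And>x. x \<in> X' \<Longrightarrow> \<phi> (\<theta> x) = x"
    and into: "\<And>x. x \<in> X' \<Longrightarrow> \<theta> x \<in> X"
    by (auto simp: homeomorphic_maps_def continuous_map_in_subtopology)
  have "\<theta> (shift x) = shift (\<theta> x)" if "x \<in> X'" for x
  proof -
    have "\<phi> (shift (\<theta> x)) = shift x"
      using assms into[OF that] inv(2)[OF that] by (simp add: conjugacy_def)
    moreover have "shift (\<theta> x) \<in> X"
      using X into[OF that] by (auto simp: shift_space_def)
    ultimately show ?thesis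
      using inv(1) by metis
  qed
  with \<theta> have "conjugacy X' X \<theta>"
    unfolding conjugacy_def homeomorphic_map_maps using homeomorphic_maps_sym by blast
  then show thesis
    using inv by (rule that)
qed

lemma conjugacy_bij_betw:
  assumes "conjugacy X X' \<phi>"
  shows "bij_betw \<phi> X X'"
  using assms by (simp add: conjugacy_def homeomorphic_eq_everything_map bij_betw_def)

text \<open>
  For the converse implication the previous transfer is applied to \<open>\<phi>\<^sup>-\<^sup>1\<close>, which intertwines \<open>\<pi>'\<close> and
  \<open>\<pi>\<close> through the inverse of \<open>\<psi>\<close>.
\<close>

lemma transition_conjugate_iff:
  assumes "shift_space X" "shift_space X'"
    and \<phi>: "conjugacy X X' \<phi>"
    and \<psi>: "inj_on \<psi> (\<pi> ` X)"
    and fib: "\<And>x. x \<in> X \<Longrightarrow> \<pi>' (\<phi> x) = \<psi> (\<pi> x)"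
    and x: "x \<in> X" "x' \<in> X"
  shows "transition X' \<pi>' (\<phi> x) (\<phi> x') \<longleftrightarrow> transition X \<pi> x x'"
proof
  assume "transition X \<pi> x x'"
  then show "transition X' \<pi>' (\<phi> x) (\<phi> x')"
    using assms by (intro transition_semiconjugate[where \<psi> = \<psi> and \<pi> = \<pi> and X = X])
      (auto simp: conjugacy_def homeomorphic_imp_continuous_map)
next
  assume *: "transition X' \<pi>' (\<phi> x) (\<phi> x')"
  obtain \<theta> where \<theta>: "conjugacy X' X \<theta>" "\<And>x. x \<in> X \<Longrightarrow> \<theta> (\<phi> x) = x" "\<And>x. x \<in> X' \<Longrightarrow> \<phi> (\<theta> x) = x"
    using conjugacy_inverse[OF assms(1) \<phi>] by blast
  have "\<pi> (\<theta> z) = inv_into (\<pi> ` X) \<psi> (\<pi>' z)" if "z \<in> X'" for z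
  proof -
    have "\<theta> z \<in> X"
      using conjugacy_bij_betw[OF \<theta>(1)] that by (rule bij_betwE[rule_format])
    with fib[of "\<theta> z"] \<theta>(3)[OF that] \<psi> show ?thesis
      by (simp add: inv_into_f_f)
  qed
  then have "transition X \<pi> (\<theta> (\<phi> x)) (\<theta> (\<phi> x'))"
    using * \<theta>(1) assms(2)
    by (intro transition_semiconjugate[where \<psi> = "inv_into (\<pi> ` X) \<psi>" and \<pi> = \<pi>' and X = X'])
      (auto simp: conjugacy_def homeomorphic_imp_continuous_map)
  with x show "transition X \<pi> x x'"
    by (simp add: \<theta>(2))
qed

text \<open>
  Since a transition class is the set of points related to one of its members, preserving and
  reflecting the relation already makes the image of a class a class; surjectivity of \<open>\<phi>\<close> makes every
  class such an image. Injectivity of \<open>\<psi>\<close> keeps classes over other points of \<open>Y\<close> away from \<open>\<psi> y\<close>.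
\<close>

lemma bij_betw_transition_classes:
  assumes "shift_space X" "shift_space X'"
    and \<phi>: "conjugacy X X' \<phi>"
    and \<psi>: "inj_on \<psi> Y" and \<pi>: "\<pi> ` X \<subseteq> Y"
    and fib: "\<And>x. x \<in> X \<Longrightarrow> \<pi>' (\<phi> x) = \<psi> (\<pi> x)"
    and y: "y \<in> Y"
  shows "bij_betw ((`) \<phi>) (transition_classes X \<pi> y) (transition_classes X' \<pi>' (\<psi> y))"
proof -
  have X': "X' = \<phi> ` X" and inj: "inj_on \<phi> X"
    using conjugacy_bij_betw[OF \<phi>] by (auto simp: bij_betw_def)
  have iff: "(\<phi> x, \<phi> x') \<in> transition_rel X' \<pi>' \<longleftrightarrow> (x, x') \<in> transition_rel X \<pi>"
    if "x \<in> X" "x' \<in> X" for x x'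
    using transition_conjugate_iff[of X X' \<phi> \<psi> \<pi> \<pi>'] assms that inj_on_subset[OF \<psi> \<pi>]
    by (simp add: transition_rel_def)
  have sub: "transition_rel X \<pi> `` {x} \<subseteq> X" "transition_rel X' \<pi>' `` {z} \<subseteq> X'" for x z
    by (auto simp: transition_rel_def transition_def)
  have class_image: "\<phi> ` (transition_rel X \<pi> `` {x}) = transition_rel X' \<pi>' `` {\<phi> x}" if "x \<in> X" for x
    using iff[OF that] sub(1)[of x] sub(2)[of "\<phi> x"] by (fastforce simp: X')
  have quot: "X' // transition_rel X' \<pi>' = (`) \<phi> ` (X // transition_rel X \<pi>)"
    using class_image by (auto simp: quotient_def X' image_UN)
  have fibre: "\<phi> ` C \<subseteq> {x \<in> X'. \<pi>' x = \<psi> y} \<longleftrightarrow> C \<subseteq> {x \<in> X. \<pi> x = y}"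
    if "C \<in> X // transition_rel X \<pi>" for C
  proof -
    have "C \<subseteq> X"
      using that sub by (auto simp: quotient_def)
    moreover have "\<pi>' (\<phi> x) = \<psi> y \<longleftrightarrow> \<pi> x = y" if "x \<in> X" for x
      using that \<psi> \<pi> y fib by (auto dest: inj_onD)
    ultimately show ?thesis
      by (auto simp: X')
  qed
  have "inj_on ((`) \<phi>) (transition_classes X \<pi> y)"
    by (rule inj_on_subset[OF inj_on_image_Pow[OF inj]]) (auto simp: transition_classes_def)
  moreover have "(`) \<phi> ` transition_classes X \<pi> y = transition_classes X' \<pi>' (\<psi> y)"
    using fibre by (auto simp: transition_classes_def quot)
  ultimately show ?thesis
    by (simp add: bij_betw_def)
qed

lemma enat_card_cong: "A \<approx> B \<Longrightarrow> enat_card A = enat_card B"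
  by (auto simp: enat_card_def eqpoll_def bij_betw_finite bij_betw_same_card)

theorem proposition4p8:
  fixes X :: "(int \<Rightarrow> 'a) set" and Y :: "(int \<Rightarrow> 'b) set"
    and X' :: "(int \<Rightarrow> 'c) set" and Y' :: "(int \<Rightarrow> 'd) set"
    and \<pi> :: "(int \<Rightarrow> 'a) \<Rightarrow> (int \<Rightarrow> 'b)" and \<pi>' :: "(int \<Rightarrow> 'c) \<Rightarrow> (int \<Rightarrow> 'd)"
    and \<phi> :: "(int \<Rightarrow> 'a) \<Rightarrow> (int \<Rightarrow> 'c)" and \<psi> :: "(int \<Rightarrow> 'b) \<Rightarrow> (int \<Rightarrow> 'd)"
  assumes "factor_triple X Y \<pi>"
    and "factor_triple X' Y' \<pi>'"
    and "conjugacy X X' \<phi>"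
    and "conjugacy Y Y' \<psi>"
    and "\<forall>x\<in>X. \<pi>' (\<phi> x) = \<psi> (\<pi> x)"
  shows "(\<forall>y\<in>Y. transition_classes X \<pi> y \<approx> transition_classes X' \<pi>' (\<psi> y)) \<and>
         class_degree X Y \<pi> = class_degree X' Y' \<pi>'"
proof
  have \<psi>: "inj_on \<psi> Y" and Y': "Y' = \<psi> ` Y"
    using conjugacy_bij_betw[OF assms(4)] by (auto simp: bij_betw_def)
  have "shift_space X" "shift_space X'" "\<pi> ` X = Y"
    using assms(1,2)
    by (auto simp: factor_triple_def factor_code_def intro: shift_space_shift_of_finite_type)
  then show classes: "\<forall>y\<in>Y. transition_classes X \<pi> y \<approx> transition_classes X' \<pi>' (\<psi> y)"
    unfolding eqpoll_def using bij_betw_transition_classes[of X X' \<phi> \<psi> Y \<pi> \<pi>'] assms(3,5) \<psi> by blast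
  show "class_degree X Y \<pi> = class_degree X' Y' \<pi>'"
    unfolding class_degree_def Y' image_image using classes by (auto intro!: INF_cong enat_card_cong)
qed

end
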